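(* Let $n$ be a positive integer and let $k$ be an integer with $0\leq k\leq n-1$. Then $H_k(n)=0$ if and only if $k\equiv 5 \pmod 6$ and $n\equiv 0 \pmod 6$.
   Context: For a positive integer $n$ and an integer $k\ge 0$, define $$a_k(n)=\prod_{\ell=0}^{n-1}\left(1-\omega_\ell-\omega_\ell^k\right),\qquad \omega_\ell=\cos\left(\tfrac{2\pi\ell}{n}\right)+i\sin\left(\tfrac{2\pi\ell}{n}\right)\in\mathbb{C},$$ which is an integer, and set $H_k(n)=|a_k(n)|$. For fixed $k$ the sequence $H_k(1),H_k(2),\dots$ is called the $k$-th Haselgrove sequence. *)

theory Defs
  imports Complex_Main "HOL-Number_Theory.Cong"
begin

definition unit_root :: "nat \<Rightarrow> nat \<Rightarrow> complex" where
  "unit_root n l =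
     complex_of_real (cos (2 * pi * real l / real n)) +
     \<i> * complex_of_real (sin (2 * pi * real l / real n))"

definition haselgrove_a :: "nat \<Rightarrow> nat \<Rightarrow> complex" where
  "haselgrove_a k n = (\<Prod>l = 0..<n. 1 - unit_root n l - unit_root n l ^ k)"

text \<open>The product is in fact an integer; it is taken in the complex numbers, so its
  absolute value is the complex modulus.\<close>

definition haselgrove_H :: "nat \<Rightarrow> nat \<Rightarrow> real" where
  "haselgrove_H k n = cmod (haselgrove_a k n)"

end

theory Submission imports Defs begin

text \<open>
  A vanishing factor gives \<open>w + w ^ k = 1\<close> with \<open>w\<close> on the unit circle, so \<open>1 - w\<close> lies on the
  unit circle as well, which forces \<open>w\<^sup>2 = w - 1\<close>: \<open>w\<close> is a primitive sixth root of unity.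
  Then \<open>w ^ n = 1\<close> and \<open>w ^ (k + 1) = w - w\<^sup>2 = 1\<close> say that 6 divides both \<open>n\<close> and \<open>k + 1\<close>.
\<close>

lemma unit_root_eq_cis: "unit_root n l = cis (2 * pi * real l / real n)"
  by (simp add: unit_root_def complex_eq_iff)

lemma unit_root_power_eq_1:
  assumes "n > 0"
  shows "unit_root n l ^ n = 1"
proof -
  have "unit_root n l ^ n = cis (2 * pi * real l)"
    using assms by (simp add: unit_root_eq_cis DeMoivre)
  also have "\<dots> = 1"
    using cis_multiple_2pi[of "real l"] by simp
  finally show ?thesis .
qed

text \<open>On the unit circle \<open>cnj w\<close> is the inverse of \<open>w\<close>. Expanding
  \<open>(1 - w) * cnj (1 - w) = 1\<close> gives \<open>w + cnj w = 1\<close>, so the inverse is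
  \<open>1 - w\<close>, that is, \<open>w * (1 - w) = 1\<close>.\<close>

lemma norm_diff_eq_1_imp_square:
  fixes w :: complex
  assumes "norm w = 1" and "norm (1 - w) = 1"
  shows "w\<^sup>2 = w - 1"
proof -
  have w: "w * cnj w = 1"
    using assms(1) by (simp add: complex_norm_square[symmetric])
  moreover have "(1 - w) * cnj (1 - w) = 1"
    by (simp only: complex_norm_square[symmetric] assms(2)) simp
  ultimately have "cnj w = 1 - w"
    by (simp add: algebra_simps)
  with w show ?thesis
    by (simp add: algebra_simps power2_eq_square)
qed

lemma sixth_root_power_eq_1_iff:
  fixes w :: complex
  assumes w: "w\<^sup>2 = w - 1"
  shows "w ^ m = 1 \<longleftrightarrow> 6 dvd m"
proof -
  have "w ^ 3 = w * (w - 1)"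
    using w by (simp add: power2_eq_square power3_eq_cube)
  also have "\<dots> = w\<^sup>2 - w"
    by (simp add: algebra_simps power2_eq_square)
  finally have w3: "w ^ 3 = -1"
    using w by simp
  have w4: "w ^ 4 = - w"
    using w3 power_add[of w 3 1] by simp
  have w5: "w ^ 5 = 1 - w"
    using w w3 power_add[of w 3 2] by simp
  have w6: "w ^ 6 = 1"
    using w3 power_add[of w 3 3] by simp
  \<comment> \<open>These are the values at which \<open>1 - w\<close>, \<open>w\<close>,
    \<open>w - 1\<close> or \<open>- w\<close>, the powers with exponents 5, 1, 2 and 4, would equal
    1. None of them satisfies \<open>w\<close>.\<close>
  have ne: "w \<noteq> 0" "w \<noteq> 1" "w \<noteq> 2" "w \<noteq> -1"
    using w by auto
  have "w ^ m = w ^ (6 * (m div 6) + m mod 6)"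
    by simp
  also have "\<dots> = w ^ (m mod 6)"
    by (simp only: power_add power_mult w6 power_one mult_1)
  finally have red: "w ^ m = w ^ (m mod 6)" .
  have "m mod 6 \<in> {0, 1, 2, 3, 4, 5}"
    using mod_less_divisor[of 6 m] by auto
  then show ?thesis
    using ne w by (auto simp: red w3 w4 w5 dvd_eq_mod_eq_0 minus_equation_iff)
qed

lemma norm_1_factor_eq_0_iff:
  fixes w :: complex
  assumes "norm w = 1"
  shows "1 - w - w ^ k = 0 \<longleftrightarrow> w\<^sup>2 = w - 1 \<and> 6 dvd k + 1"
proof
  assume "1 - w - w ^ k = 0"
  then have wk: "1 - w = w ^ k"
    by simp
  have sq: "w\<^sup>2 = w - 1"
    by (rule norm_diff_eq_1_imp_square) (simp_all add: assms wk norm_power)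
  have "w ^ (k + 1) = w * (1 - w)"
    by (simp add: wk)
  also have "\<dots> = 1"
    using sq by (simp add: algebra_simps power2_eq_square)
  finally show "w\<^sup>2 = w - 1 \<and> 6 dvd k + 1"
    using sq sixth_root_power_eq_1_iff by blast
next
  assume *: "w\<^sup>2 = w - 1 \<and> 6 dvd k + 1"
  \<comment> \<open>Both \<open>w ^ k\<close> and \<open>1 - w\<close> turn out to be inverses of
    \<open>w\<close>, hence they agree.\<close>
  then have "w * w ^ k = 1"
    using sixth_root_power_eq_1_iff[of w "k + 1"] by simp
  moreover have "w * (1 - w) = 1"
    using * by (simp add: algebra_simps power2_eq_square)
  ultimately have "w * (1 - w - w ^ k) = 0"
    by (simp add: algebra_simps)
  then show "1 - w - w ^ k = 0"
    using assms by auto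
qed

text \<open>The index \<open>m\<close> is one sixth of the order, so the angle is
  \<open>pi / 3\<close> and the root is a primitive sixth root of unity.\<close>

lemma unit_root_sixth_square:
  assumes "m > 0"
  shows "(unit_root (6 * m) m)\<^sup>2 = unit_root (6 * m) m - 1"
proof -
  have "2 * pi * real m / real (6 * m) = pi / 3"
    using assms by (simp add: field_simps)
  then have eq: "unit_root (6 * m) m = cis (pi / 3)"
    by (simp only: unit_root_eq_cis)
  show ?thesis
    unfolding eq by (simp add: complex_eq_iff power2_eq_square cos_60 sin_60)
qed

theorem proposition1p6:
  fixes n k :: nat
  assumes "n > 0" and "0 \<le> k" and "k \<le> n - 1"
  shows "haselgrove_H k n = 0 \<longleftrightarrow> [k = 5] (mod 6) \<and> [n = 0] (mod 6)"
proof -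
  have k: "6 dvd k + 1 \<longleftrightarrow> [k = 5] (mod 6)"
    unfolding cong_def by presburger
  have n: "6 dvd n \<longleftrightarrow> [n = 0] (mod 6)"
    by (simp add: cong_0_iff)
  have "haselgrove_H k n = 0 \<longleftrightarrow> (\<exists>l<n. 1 - unit_root n l - unit_root n l ^ k = 0)"
    by (auto simp: haselgrove_H_def haselgrove_a_def)
  \<comment> \<open>The condition on \<open>k\<close> is the same for every root, so it leaves the
    existential quantifier.\<close>
  also have "\<dots> \<longleftrightarrow> (\<exists>l<n. (unit_root n l)\<^sup>2 = unit_root n l - 1) \<and> 6 dvd k + 1"
    using norm_1_factor_eq_0_iff[of "unit_root n _" k] by (auto simp: unit_root_eq_cis)
  also have "(\<exists>l<n. (unit_root n l)\<^sup>2 = unit_root n l - 1) \<longleftrightarrow> 6 dvd n"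
  proof
    assume "\<exists>l<n. (unit_root n l)\<^sup>2 = unit_root n l - 1"
    then show "6 dvd n"
      using unit_root_power_eq_1[OF assms(1)] sixth_root_power_eq_1_iff by blast
  next
    assume "6 dvd n"
    then obtain m where "n = 6 * m" ..
    \<comment> \<open>Positivity of \<open>n = 6 * m\<close> gives \<open>m > 0\<close> and hence
      \<open>m < n\<close>, so the index \<open>m\<close> is in range.\<close>
    then show "\<exists>l<n. (unit_root n l)\<^sup>2 = unit_root n l - 1"
      using assms(1) unit_root_sixth_square[of m] by (intro exI[of _ m]) auto
  qed
  finally show ?thesis
    using k n by blast
qed

end
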